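(* All the elements of the group $\mathbb{M}$ of Möbius transformations of $\Delta_{\mathbb{H}}$, as well as the map $q\mapsto\overline{q}$, leave the Poincaré differential metric of $\Delta_{\mathbb{H}}$ invariant.
   Context: $\mathbb{H}\cong\mathbb{R}^4$ is the skew field of real quaternions and $\Delta_{\mathbb{H}}=\{q\in\mathbb{H}:|q|<1\}$. $\mathbb{M}$ is the group of all maps $q\mapsto(aq+b)(cq+d)^{-1}$ ($a,b,c,d\in\mathbb{H}$, $\begin{bmatrix} a & b\\ c & d\end{bmatrix}$ an invertible quaternionic matrix) which map $\Delta_{\mathbb{H}}$ onto itself. The Poincaré differential metric assigns to a vector $\tau\in\mathbb{H}$ at $q\in\Delta_{\mathbb{H}}$ the length $\langle\tau\rangle_q=\dfrac{|\tau|}{1-|q|^2}$. A diffeomorphism $f$ of $\Delta_{\mathbb{H}}$ leaves it invariant if $\langle df_q(\tau)\rangle_{f(q)}=\langle\tau\rangle_q$ for all $q\in\Delta_{\mathbb{H}}$, $\tau\in\mathbb{H}$, where $df_q$ is the real differential. *)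

theory Defs
  imports "HOL-Analysis.Analysis"
begin

section \<open>Real quaternions\<close>

text \<open>\<open>Quat x0 x1 x2 x3\<close> is the quaternion $x_0 + x_1 i + x_2 j + x_3 k$.\<close>

datatype quat = Quat (q0: real) (q1: real) (q2: real) (q3: real)

lemma quat_eq_iff: "x = y \<longleftrightarrow> q0 x = q0 y \<and> q1 x = q1 y \<and> q2 x = q2 y \<and> q3 x = q3 y"
  by (cases x; cases y) simp

definition qcnj :: "quat \<Rightarrow> quat"
  where "qcnj x = Quat (q0 x) (- q1 x) (- q2 x) (- q3 x)"

instantiation quat :: real_normed_div_algebra
begin

definition "0 = Quat 0 0 0 0"
definition "1 = Quat 1 0 0 0"
definition "x + y = Quat (q0 x + q0 y) (q1 x + q1 y) (q2 x + q2 y) (q3 x + q3 y)"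
definition "- x = Quat (- q0 x) (- q1 x) (- q2 x) (- q3 x)"
definition "x - y = Quat (q0 x - q0 y) (q1 x - q1 y) (q2 x - q2 y) (q3 x - q3 y)"
definition "x * y = Quat
  (q0 x * q0 y - q1 x * q1 y - q2 x * q2 y - q3 x * q3 y)
  (q0 x * q1 y + q1 x * q0 y + q2 x * q3 y - q3 x * q2 y)
  (q0 x * q2 y - q1 x * q3 y + q2 x * q0 y + q3 x * q1 y)
  (q0 x * q3 y + q1 x * q2 y - q2 x * q1 y + q3 x * q0 y)"
definition "r *\<^sub>R x = Quat (r * q0 x) (r * q1 x) (r * q2 x) (r * q3 x)"
definition "norm x = sqrt ((q0 x)\<^sup>2 + (q1 x)\<^sup>2 + (q2 x)\<^sup>2 + (q3 x)\<^sup>2)"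
definition "inverse x = inverse ((norm x)\<^sup>2) *\<^sub>R qcnj x"
definition "x div (y::quat) = x * inverse y"
definition "sgn x = inverse (norm x) *\<^sub>R (x::quat)"
definition "dist x y = norm (x - (y::quat))"
definition [code del]:
  "(uniformity :: (quat \<times> quat) filter) = (INF e\<in>{0 <..}. principal {(x, y). dist x y < e})"
definition [code del]:
  "open (U :: quat set) \<longleftrightarrow> (\<forall>x\<in>U. eventually (\<lambda>(x', y). x' = x \<longrightarrow> y \<in> U) uniformity)"

instance
proof
  fix x y z :: quat and r s :: real and U :: "quat set"
  note defs = zero_quat_def one_quat_def plus_quat_def uminus_quat_def minus_quat_def
    times_quat_def scaleR_quat_def qcnj_def
  show "x + y + z = x + (y + z)" "x + y = y + x" "0 + x = x" "- x + x = 0" "x - y = x + - y"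
    "x * y * z = x * (y * z)" "(x + y) * z = x * z + y * z" "x * (y + z) = x * y + x * z"
    "1 * x = x" "x * 1 = x" "(0::quat) \<noteq> 1"
    "r *\<^sub>R (x + y) = r *\<^sub>R x + r *\<^sub>R y" "(r + s) *\<^sub>R x = r *\<^sub>R x + s *\<^sub>R x"
    "r *\<^sub>R s *\<^sub>R x = (r * s) *\<^sub>R x" "1 *\<^sub>R x = x"
    "r *\<^sub>R x * y = r *\<^sub>R (x * y)" "x * r *\<^sub>R y = r *\<^sub>R (x * y)"
    by (simp_all add: defs quat_eq_iff algebra_simps)
  have nrm: "norm w = norm ((q0 w, q1 w), (q2 w, q3 w))" for w
    by (simp add: norm_quat_def norm_Pair)
  have zero: "norm w = 0 \<longleftrightarrow> w = 0" for w :: quat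
    unfolding nrm by (simp add: quat_eq_iff zero_quat_def zero_prod_def)
  have sq: "(norm w)\<^sup>2 = (q0 w)\<^sup>2 + (q1 w)\<^sup>2 + (q2 w)\<^sup>2 + (q3 w)\<^sup>2" for w :: quat
    by (simp add: norm_quat_def)
  show "norm x = 0 \<longleftrightarrow> x = 0" by (rule zero)
  show "norm (x + y) \<le> norm x + norm y"
    using norm_triangle_ineq[of "((q0 x, q1 x), (q2 x, q3 x))" "((q0 y, q1 y), (q2 y, q3 y))"]
    by (simp add: nrm plus_quat_def)
  show "norm (r *\<^sub>R x) = \<bar>r\<bar> * norm x"
    using norm_scaleR[of r "((q0 x, q1 x), (q2 x, q3 x))"]
    by (simp add: nrm scaleR_quat_def)
  show "norm (x * y) = norm x * norm y"
    unfolding norm_quat_def real_sqrt_mult[symmetric]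
    by (rule arg_cong[where f = sqrt])
      (simp add: times_quat_def power2_eq_square algebra_simps)
  show "inverse x * x = 1" "x * inverse x = 1" if "x \<noteq> 0"
  proof -
    have ne: "(norm x)\<^sup>2 \<noteq> 0"
      using that by (simp add: zero)
    have "qcnj x * x = (norm x)\<^sup>2 *\<^sub>R 1" "x * qcnj x = (norm x)\<^sup>2 *\<^sub>R 1"
      unfolding sq by (simp_all add: defs quat_eq_iff algebra_simps power2_eq_square)
    moreover have "(r *\<^sub>R u) * v = r *\<^sub>R (u * v)" "v * (r *\<^sub>R u) = r *\<^sub>R (v * u)"
      "r *\<^sub>R s *\<^sub>R u = (r * s) *\<^sub>R u" "1 *\<^sub>R u = u" for u v :: quat and r s :: real
      by (simp_all add: defs quat_eq_iff algebra_simps)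
    ultimately show "inverse x * x = 1" "x * inverse x = 1"
      using ne by (simp_all add: inverse_quat_def)
  qed
  show "inverse (0::quat) = 0"
    by (simp add: inverse_quat_def defs)
  show "x div y = x * inverse y" "sgn x = inverse (norm x) *\<^sub>R x" "dist x y = norm (x - y)"
    by (simp_all add: divide_quat_def sgn_quat_def dist_quat_def)
  show "(uniformity :: (quat \<times> quat) filter) = (INF e\<in>{0 <..}. principal {(x, y). dist x y < e})"
    by (rule uniformity_quat_def)
  show "open U \<longleftrightarrow> (\<forall>x\<in>U. eventually (\<lambda>(x', y). x' = x \<longrightarrow> y \<in> U) uniformity)"
    by (rule open_quat_def)
qed

end

section \<open>The quaternionic unit ball and its Moebius transformations\<close>

definition Delta_H :: "quat set"
  where "Delta_H = {q. norm q < 1}"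

definition moebius :: "quat^2^2 \<Rightarrow> quat \<Rightarrow> quat"
  where "moebius A q = (A $ 1 $ 1 * q + A $ 1 $ 2) * inverse (A $ 2 $ 1 * q + A $ 2 $ 2)"

text \<open>
  Elements of the group are regarded as maps on the ball, hence the restriction. A map with a
  pole in the ball does not send the ball into itself; as \<open>inverse 0 = 0\<close> in HOL, the
  absence of poles in the ball is required explicitly.
\<close>

definition MM :: "(quat \<Rightarrow> quat) set"
  where "MM = {restrict (moebius A) Delta_H | A.
    invertible A \<and> (\<forall>q\<in>Delta_H. A $ 2 $ 1 * q + A $ 2 $ 2 \<noteq> 0) \<and>
    moebius A ` Delta_H = Delta_H}"

section \<open>Diffeomorphisms and the Poincare differential metric\<close>

text \<open>
  \<open>Ck_on k S f\<close> says that \<open>f\<close> is of class $C^k$ on the open set \<open>S\<close>. Higher derivatives are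
  taken as iterated directional derivatives of the Frechet derivative, which in finite dimension
  is the usual notion.
\<close>

fun Ck_on :: "nat \<Rightarrow> 'a::real_normed_vector set \<Rightarrow> ('a \<Rightarrow> 'b::real_normed_vector) \<Rightarrow> bool"
  where
    "Ck_on 0 S f \<longleftrightarrow> continuous_on S f"
  | "Ck_on (Suc k) S f \<longleftrightarrow> (\<forall>x\<in>S. f differentiable (at x)) \<and>
      (\<forall>v. Ck_on k S (\<lambda>x. frechet_derivative f (at x) v))"

definition smooth_on :: "'a::real_normed_vector set \<Rightarrow> ('a \<Rightarrow> 'b::real_normed_vector) \<Rightarrow> bool"
  where "smooth_on S f \<longleftrightarrow> (\<forall>k. Ck_on k S f)"

definition self_diffeomorphism :: "'a::real_normed_vector set \<Rightarrow> ('a \<Rightarrow> 'a) \<Rightarrow> bool"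
  where "self_diffeomorphism S f \<longleftrightarrow>
    bij_betw f S S \<and> smooth_on S f \<and> smooth_on S (inv_into S f)"

definition poincare_length :: "quat \<Rightarrow> quat \<Rightarrow> real"
  where "poincare_length q \<tau> = norm \<tau> / (1 - (norm q)\<^sup>2)"

definition leaves_poincare_metric_invariant :: "(quat \<Rightarrow> quat) \<Rightarrow> bool"
  where "leaves_poincare_metric_invariant f \<longleftrightarrow>
    self_diffeomorphism Delta_H f \<and>
    (\<forall>q\<in>Delta_H. \<forall>\<tau>.
      poincare_length (f q) (frechet_derivative f (at q) \<tau>) = poincare_length q \<tau>)"

end

theory Submission
  imports Defs
begin

text \<open>
  Write $u(q) = aq+b$ and $v(q) = cq+d$, so that $f = u v^{-1}$. If $f$ maps the ball onto
  itself, then $|u| < |v|$ in the ball, hence $|u| \<le> |v|$ on the closed ball, and on the unit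
  sphere equality must hold: a point of the sphere with $|u| < |v|$ is not a pole and goes into the
  open ball, so it would share its image with a point of the ball, which the inverse matrix
  forbids. This is \<open>norm_moebius_sphere\<close>.

  Now $|v|^2 - |u|^2$ is a real quadratic polynomial vanishing on the sphere. Comparing its values
  at $q$ and $-q$ shows that it has no linear part, so it equals $K(1-|q|^2)$ with
  $K = |d|^2-|b|^2$. The coefficient relations obtained in this way give the polarised identity
  $\overline{v(x)}v(y) - \overline{u(x)}u(y) = K(1-\overline{x}y)$
  (\<open>hermitian_form_from_sphere\<close>). Dividing by $v(x)$ and $v(y)$,
  $$1-\overline{f(x)}f(y) = \overline{v(x)^{-1}}\,K(1-\overline{x}y)\,v(y)^{-1}.$$
  Together with $|1-\overline{x}y|^2 = |x-y|^2 + (1-|x|^2)(1-|y|^2)$ this yields the two formulas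
  of \<open>moebius_difference_norm\<close>:
  $$1-|f(x)|^2 = \frac{K(1-|x|^2)}{|v(x)|^2}, \qquad
    |f(y)-f(x)| = \frac{|K|\,|y-x|}{|v(y)|\,|v(x)|}.$$
  Letting $y$ tend to $x$ in the second one shows that $df_x$ multiplies norms by $K/|v(x)|^2$,
  and by the first one $1-|x|^2$ changes by the same factor.

  Smoothness of $f$ and of its inverse, again a Moebius transformation, follows because the
  functions built from bounded linear maps and constants by sums, products and inverses are
  differentiable with derivatives of the same kind. Conjugation is a linear isometry.
\<close>

section \<open>Smoothness of rational functions\<close>

text \<open>
  Closure of this class under directional derivatives gives smoothness of all its members at once,
  without separate $C^k$ rules for products and inverses. All bounded linear maps are generators,
  rather than the identity alone, in order to include conjugation.
\<close>
inductive rational_on :: "'a::real_normed_vector set \<Rightarrow> ('a \<Rightarrow> 'b::real_normed_div_algebra) \<Rightarrow> bool"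
  for S where
  const: "rational_on S (\<lambda>x. c)"
| linear: "bounded_linear L \<Longrightarrow> rational_on S L"
| add: "rational_on S f \<Longrightarrow> rational_on S g \<Longrightarrow> rational_on S (\<lambda>x. f x + g x)"
| mult: "rational_on S f \<Longrightarrow> rational_on S g \<Longrightarrow> rational_on S (\<lambda>x. f x * g x)"
| inverse: "rational_on S f \<Longrightarrow> (\<And>x. x \<in> S \<Longrightarrow> f x \<noteq> 0) \<Longrightarrow> rational_on S (\<lambda>x. inverse (f x))"

text \<open>
  The sum, product and quotient rules express each derivative by members of the class. For the
  inverse the rule is $v \<mapsto> -f^{-1}\,(df\,v)\,f^{-1}$, in this order, as the algebra need not be
  commutative.
\<close>
lemma rational_on_derivative:
  assumes "rational_on S f"
  shows "\<exists>f'. (\<forall>x\<in>S. (f has_derivative f' x) (at x)) \<and> (\<forall>v. rational_on S (\<lambda>x. f' x v))"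
  using assms
proof induction
  case (const c)
  show ?case by (rule exI[of _ "\<lambda>x v. 0"]) (auto intro: rational_on.const)
next
  case (linear L)
  then show ?case
    by (intro exI[of _ "\<lambda>x. L"]) (auto intro: rational_on.const bounded_linear_imp_has_derivative)
next
  case (add f g)
  then obtain f' g' where
    "\<forall>x\<in>S. (f has_derivative f' x) (at x)" "\<forall>v. rational_on S (\<lambda>x. f' x v)"
    "\<forall>x\<in>S. (g has_derivative g' x) (at x)" "\<forall>v. rational_on S (\<lambda>x. g' x v)"
    by blast
  then show ?case
    by (intro exI[of _ "\<lambda>x v. f' x v + g' x v"])
      (auto intro: rational_on.add has_derivative_add)
next
  case (mult f g)
  then obtain f' g' where
    "\<forall>x\<in>S. (f has_derivative f' x) (at x)" "\<forall>v. rational_on S (\<lambda>x. f' x v)"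
    "\<forall>x\<in>S. (g has_derivative g' x) (at x)" "\<forall>v. rational_on S (\<lambda>x. g' x v)"
    by blast
  with mult.hyps show ?case
    by (intro exI[of _ "\<lambda>x v. f x * g' x v + f' x v * g x"])
      (auto intro!: rational_on.add has_derivative_mult intro: rational_on.mult)
next
  case (inverse f)
  then obtain f' where
    "\<forall>x\<in>S. (f has_derivative f' x) (at x)" "\<forall>v. rational_on S (\<lambda>x. f' x v)"
    by blast
  \<comment> \<open>The class has no rule for negation, so the sign enters as a constant factor.\<close>
  moreover have "rational_on S (\<lambda>x. (-1) * (inverse (f x) * f' x v * inverse (f x)))" for v
    using inverse.hyps calculation(2)
    by (intro rational_on.mult rational_on.const rational_on.inverse) auto
  ultimately show ?case
    using inverse.hyps(2)
    by (intro exI[of _ "\<lambda>x v. - (inverse (f x) * f' x v * inverse (f x))"])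
      (auto intro: has_derivative_inverse)
qed

lemma Ck_on_cong:
  assumes "open S" "\<And>x. x \<in> S \<Longrightarrow> f x = g x" "Ck_on k S f"
  shows "Ck_on k S g"
  using assms(2,3)
proof (induction k arbitrary: f g)
  case 0
  then show ?case by (auto cong: continuous_on_cong)
next
  case (Suc k)
  have der: "(g has_derivative frechet_derivative f (at x)) (at x)" if "x \<in> S" for x
  proof (rule has_derivative_transform_within_open[OF _ \<open>open S\<close> that Suc.prems(1)])
    show "(f has_derivative frechet_derivative f (at x)) (at x)"
      using Suc.prems(2) that by (simp add: frechet_derivative_works[symmetric])
  qed
  then have "frechet_derivative f (at x) v = frechet_derivative g (at x) v" if "x \<in> S" for x v
    using frechet_derivative_at[OF der[OF that]] by simp
  then have "Ck_on k S (\<lambda>x. frechet_derivative g (at x) v)" for v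
    using Suc.IH[of "\<lambda>x. frechet_derivative f (at x) v"] Suc.prems(2) by simp
  with der show ?case by (auto simp: differentiable_def)
qed

lemma rational_on_imp_smooth_on:
  assumes "open S" "rational_on S f"
  shows "smooth_on S f"
proof -
  have "Ck_on k S f" for k
    using assms(2)
  proof (induction k arbitrary: f)
    case 0
    then show ?case
      using rational_on_derivative[OF 0]
      by (auto intro: continuous_at_imp_continuous_on has_derivative_continuous)
  next
    case (Suc k)
    obtain f' where f': "\<And>x. x \<in> S \<Longrightarrow> (f has_derivative f' x) (at x)"
      and r: "\<And>v. rational_on S (\<lambda>x. f' x v)"
      using rational_on_derivative[OF Suc.prems] by blast
    have "Ck_on k S (\<lambda>x. frechet_derivative f (at x) v)" for v
      by (rule Ck_on_cong[OF \<open>open S\<close> _ Suc.IH[OF r[of v]]])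
        (simp add: frechet_derivative_at[OF f', symmetric])
    with f' show ?case by (auto simp: differentiable_def)
  qed
  then show ?thesis by (simp add: smooth_on_def)
qed

lemma smooth_on_cong:
  "open S \<Longrightarrow> (\<And>x. x \<in> S \<Longrightarrow> f x = g x) \<Longrightarrow> smooth_on S f \<Longrightarrow> smooth_on S g"
  unfolding smooth_on_def using Ck_on_cong by blast

text \<open>
  Smoothness of \<open>inv_into S f\<close> may be tested on any two-sided inverse, since the two agree on the
  open set \<open>S\<close>.
\<close>
lemma self_diffeomorphismI:
  assumes "open S" "f ` S \<subseteq> S" "g ` S \<subseteq> S"
    and "\<And>x. x \<in> S \<Longrightarrow> g (f x) = x" "\<And>x. x \<in> S \<Longrightarrow> f (g x) = x"
    and "smooth_on S f" "smooth_on S g"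
  shows "self_diffeomorphism S f"
proof -
  have bij: "bij_betw f S S"
    by (rule bij_betw_byWitness[where f' = g]) (use assms in auto)
  have "inv_into S f x = g x" if "x \<in> S" for x
    using assms that bij by (intro inv_into_f_eq) (auto simp: bij_betw_def)
  then have "smooth_on S (inv_into S f)"
    using smooth_on_cong[OF \<open>open S\<close> _ assms(7)] by simp
  with bij assms(6) show ?thesis by (simp add: self_diffeomorphism_def)
qed

section \<open>Conformal maps and their derivatives\<close>

text \<open>
  The derivative along \<open>v\<close> is the limit of $(f(x+tv)-f(x))/t$, whose norm is $g(x+tv)\,|v|$ by
  hypothesis; continuity of \<open>g\<close> identifies the limit.
\<close>
lemma norm_derivative_eq_of_difference_quotient:
  fixes f :: "'a::real_normed_vector \<Rightarrow> 'b::real_normed_vector"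
  assumes S: "open S" "x \<in> S" and D: "(f has_derivative D) (at x)"
    and g: "isCont g x" and eq: "\<And>y. y \<in> S \<Longrightarrow> norm (f y - f x) = g y * norm (y - x)"
  shows "norm (D v) = g x * norm v"
proof -
  have line: "((\<lambda>t::real. x + t *\<^sub>R v) \<longlongrightarrow> x) (at 0)"
    by (rule tendsto_eq_intros refl | simp)+
  have "((\<lambda>t. x + t *\<^sub>R v) has_derivative (\<lambda>t. t *\<^sub>R v)) (at 0)"
    by (auto intro!: derivative_eq_intros)
  then have "((\<lambda>t. f (x + t *\<^sub>R v)) has_derivative (\<lambda>t. D (t *\<^sub>R v))) (at 0)"
    by (rule has_derivative_compose) (use D in simp)
  then have "((\<lambda>t. norm (f (x + t *\<^sub>R v) - f x - D (t *\<^sub>R v)) / norm t) \<longlongrightarrow> 0) (at 0)"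
    by (simp add: has_derivative_at)
  moreover have "norm (f (x + t *\<^sub>R v) - f x - D (t *\<^sub>R v)) / norm t
      = norm ((f (x + t *\<^sub>R v) - f x) /\<^sub>R t - D v)" if "t \<noteq> 0" for t
  proof -
    have "f (x + t *\<^sub>R v) - f x - D (t *\<^sub>R v) = t *\<^sub>R ((f (x + t *\<^sub>R v) - f x) /\<^sub>R t - D v)"
      using that linear_scale[OF has_derivative_linear[OF D]] by (simp add: scaleR_diff_right)
    then show ?thesis using that by simp
  qed
  then have "eventually (\<lambda>t. norm (f (x + t *\<^sub>R v) - f x - D (t *\<^sub>R v)) / norm t
      = norm ((f (x + t *\<^sub>R v) - f x) /\<^sub>R t - D v)) (at 0)"
    by (simp add: eventually_at_filter)
  ultimately have "((\<lambda>t. norm ((f (x + t *\<^sub>R v) - f x) /\<^sub>R t - D v)) \<longlongrightarrow> 0) (at 0)"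
    by (rule Lim_transform_eventually)
  then have "((\<lambda>t. (f (x + t *\<^sub>R v) - f x) /\<^sub>R t) \<longlongrightarrow> D v) (at 0)"
    by (subst Lim_null) (rule tendsto_norm_zero_cancel)
  then have 1: "((\<lambda>t. norm ((f (x + t *\<^sub>R v) - f x) /\<^sub>R t)) \<longlongrightarrow> norm (D v)) (at 0)"
    by (rule tendsto_norm)
  have "eventually (\<lambda>t. x + t *\<^sub>R v \<in> S) (at 0)"
    using line S topological_tendstoD by blast
  then have "eventually (\<lambda>t. norm ((f (x + t *\<^sub>R v) - f x) /\<^sub>R t)
      = g (x + t *\<^sub>R v) * norm v) (at 0)"
    using eventually_at_topological[of "\<lambda>t. t \<noteq> 0" "0::real"]
    by (auto simp: eventually_at_filter eq elim!: eventually_mono)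
  with 1 have "((\<lambda>t. g (x + t *\<^sub>R v) * norm v) \<longlongrightarrow> norm (D v)) (at 0)"
    by (rule Lim_transform_eventually)
  moreover have "((\<lambda>t. g (x + t *\<^sub>R v) * norm v) \<longlongrightarrow> g x * norm v) (at 0)"
    by (intro tendsto_mult_right isCont_tendsto_compose[OF g line])
  ultimately show ?thesis
    by (rule tendsto_unique[rotated]) simp
qed

section \<open>Quaternionic identities\<close>

lemmas quat_coordinates = zero_quat_def one_quat_def plus_quat_def uminus_quat_def
  minus_quat_def times_quat_def scaleR_quat_def qcnj_def

lemma norm_quat_squared: "(norm (x::quat))\<^sup>2 = (q0 x)\<^sup>2 + (q1 x)\<^sup>2 + (q2 x)\<^sup>2 + (q3 x)\<^sup>2"
  by (simp add: norm_quat_def)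

lemma qcnj_add: "qcnj (x + y) = qcnj x + qcnj y"
  by (simp add: quat_coordinates)

lemma qcnj_mult: "qcnj (x * y) = qcnj y * qcnj x"
  by (simp add: quat_coordinates algebra_simps)

lemma qcnj_qcnj [simp]: "qcnj (qcnj x) = x"
  by (simp add: quat_coordinates)

lemma qcnj_mult_self: "qcnj x * x = of_real ((norm x)\<^sup>2)"
  unfolding of_real_def norm_quat_squared
  by (simp add: quat_coordinates algebra_simps power2_eq_square)

lemma norm_qcnj [simp]: "norm (qcnj x) = norm x"
  by (simp add: norm_quat_def qcnj_def)

lemma bounded_linear_qcnj: "bounded_linear qcnj"
  by (rule bounded_linear_intro[where K = 1]) (simp_all add: quat_coordinates norm_quat_def)

text \<open>
  The bridge from the form $1-\overline{x}y$, which Moebius transformations of the ball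
  multiply by simple factors, to the distance $|x-y|$.
\<close>
lemma norm_one_minus_qcnj_mult_squared:
  "(norm (1 - qcnj x * y))\<^sup>2 = (norm (x - y))\<^sup>2 + (1 - (norm x)\<^sup>2) * (1 - (norm y)\<^sup>2)"
  unfolding norm_quat_squared by (simp add: quat_coordinates algebra_simps power2_eq_square)

lemma norm_add_quat_squared:
  fixes x y :: quat
  shows "(norm (x + y))\<^sup>2 = (norm x)\<^sup>2 + (norm y)\<^sup>2 + 2 * q0 (qcnj x * y)"
  unfolding norm_quat_squared by (simp add: quat_coordinates algebra_simps power2_eq_square)

section \<open>Moebius transformations preserving the ball\<close>

lemma Delta_H_eq_ball: "Delta_H = ball 0 1"
  by (auto simp: Delta_H_def)

lemma open_Delta_H: "open Delta_H"
  by (simp add: Delta_H_eq_ball)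

lemma closure_Delta_H: "closure Delta_H = cball 0 1"
  by (simp add: Delta_H_eq_ball)

text \<open>
  On the unit sphere the hypothesis reads
  $|a|^2+|b|^2+2\,\mathrm{Re}(\overline{q}\,w) = |c|^2+|d|^2$ with
  $w = \overline{a}b-\overline{c}d$. Replacing $q$ by $-q$ gives $\mathrm{Re}(\overline{q}\,w)=0$,
  and $q = w/|w|$ then forces $w = 0$. What remains is $|a|^2+|b|^2 = |c|^2+|d|^2$, and these two
  relations are what the expansion of the polarised form needs.
\<close>
lemma hermitian_form_from_sphere:
  fixes a b c d :: quat
  assumes sphere: "\<And>q. norm q = 1 \<Longrightarrow> norm (a * q + b) = norm (c * q + d)"
  defines "K \<equiv> (norm d)\<^sup>2 - (norm b)\<^sup>2"
  shows "qcnj (c * x + d) * (c * y + d) - qcnj (a * x + b) * (a * y + b)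
    = of_real K * (1 - qcnj x * y)"
proof -
  define w where "w = qcnj a * b - qcnj c * d"
  have eq: "(norm a)\<^sup>2 + (norm b)\<^sup>2 + 2 * q0 (qcnj q * w) = (norm c)\<^sup>2 + (norm d)\<^sup>2"
    if "norm q = 1" for q
  proof -
    have "(norm (a * q + b))\<^sup>2 = (norm (c * q + d))\<^sup>2"
      using sphere[OF that] by simp
    moreover have "q0 (qcnj q * w) = q0 (qcnj (a * q) * b) - q0 (qcnj (c * q) * d)"
      by (simp add: w_def qcnj_mult algebra_simps) (simp add: minus_quat_def)
    ultimately show ?thesis
      by (simp add: norm_add_quat_squared norm_mult that)
  qed
  have "w = 0"
  proof (rule ccontr)
    assume "w \<noteq> 0"
    have "qcnj (- q) * w = - (qcnj q * w)" "q0 (- q) = - q0 q" for q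
      by (simp_all add: quat_coordinates)
    with \<open>w \<noteq> 0\<close> have "q0 (qcnj (sgn w) * w) = 0"
      using eq[of "sgn w"] eq[of "- sgn w"] by (simp add: norm_sgn)
    moreover have "qcnj (sgn w) * w = inverse (norm w) *\<^sub>R of_real ((norm w)\<^sup>2)"
      unfolding sgn_quat_def qcnj_mult_self[symmetric]
      by (simp add: linear_scale[OF bounded_linear.linear[OF bounded_linear_qcnj]])
    ultimately show False
      using \<open>w \<noteq> 0\<close> by (simp add: of_real_def quat_coordinates)
  qed
  then have ab: "qcnj a * b = qcnj c * d" by (simp add: w_def)
  from arg_cong[OF this, of qcnj] have ba: "qcnj b * a = qcnj d * c"
    by (simp add: qcnj_mult)
  have "(norm c)\<^sup>2 - (norm a)\<^sup>2 = - K"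
    using eq[of 1] by (simp add: K_def \<open>w = 0\<close>) (simp add: zero_quat_def)
  then have "qcnj c * c - qcnj a * a = - of_real K" "qcnj d * d - qcnj b * b = of_real K"
    unfolding qcnj_mult_self K_def by (metis of_real_diff of_real_minus)+
  then have sq: "qcnj c * c = qcnj a * a - of_real K" "qcnj d * d = qcnj b * b + of_real K"
    by (simp_all add: algebra_simps)
  have "qcnj (c * x + d) * (c * y + d)
      = qcnj x * (qcnj c * c) * y + qcnj x * (qcnj c * d) + qcnj d * c * y + qcnj d * d"
    by (simp add: qcnj_add qcnj_mult algebra_simps)
  also have "\<dots> = qcnj (a * x + b) * (a * y + b) + of_real K * (1 - qcnj x * y)"
    unfolding sq ab[symmetric] ba[symmetric]
    by (simp add: qcnj_add qcnj_mult algebra_simps of_real_def)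
  finally show ?thesis by simp
qed

text \<open>
  Both formulas come from the polarised form divided by $v(x)$ and $v(y)$: the first on the
  diagonal, the second by subtracting $(1-|x|^2)(1-|y|^2)$ from $|1-\overline{y}x|^2$.
\<close>
lemma moebius_difference_norm:
  fixes a b c d :: quat
  assumes "\<And>q. norm q = 1 \<Longrightarrow> norm (a * q + b) = norm (c * q + d)"
  defines "K \<equiv> (norm d)\<^sup>2 - (norm b)\<^sup>2"
    and "f \<equiv> \<lambda>q. (a * q + b) * inverse (c * q + d)"
  assumes x: "c * x + d \<noteq> 0" and y: "c * y + d \<noteq> 0"
  shows "1 - (norm (f x))\<^sup>2 = K * (1 - (norm x)\<^sup>2) / (norm (c * x + d))\<^sup>2"
    and "norm (f y - f x) = \<bar>K\<bar> / (norm (c * y + d) * norm (c * x + d)) * norm (y - x)"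
proof -
  note form = hermitian_form_from_sphere[OF assms(1), folded K_def]
  have diag: "1 - (norm (f z))\<^sup>2 = K * (1 - (norm z)\<^sup>2) / (norm (c * z + d))\<^sup>2"
    if "c * z + d \<noteq> 0" for z
  proof -
    have "(of_real ((norm (c * z + d))\<^sup>2 - (norm (a * z + b))\<^sup>2) :: quat)
        = of_real (K * (1 - (norm z)\<^sup>2))"
      using form[of z z] unfolding qcnj_mult_self by simp
    then have "(norm (c * z + d))\<^sup>2 - (norm (a * z + b))\<^sup>2 = K * (1 - (norm z)\<^sup>2)"
      unfolding of_real_eq_iff .
    moreover have "(norm (f z))\<^sup>2 = (norm (a * z + b))\<^sup>2 / (norm (c * z + d))\<^sup>2"
      by (simp add: f_def norm_mult norm_inverse divide_inverse power_mult_distrib power_inverse)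
    ultimately show ?thesis
      using that by (simp add: field_simps)
  qed
  show "1 - (norm (f x))\<^sup>2 = K * (1 - (norm x)\<^sup>2) / (norm (c * x + d))\<^sup>2"
    using diag[OF x] .
  define v where "v z = c * z + d" for z
  have v: "v x \<noteq> 0" "v y \<noteq> 0" using x y by (simp_all add: v_def)
  define r where "r = K / (norm (v y) * norm (v x))"
  have "qcnj (inverse (v y)) * qcnj (v y) = 1"
    by (metis qcnj_mult right_inverse v(2) qcnj_mult_self norm_one of_real_1 power_one mult_1_right qcnj_qcnj)
  moreover have fv: "f z = (a * z + b) * inverse (v z)" for z
    by (simp add: f_def v_def)
  ultimately have "1 - qcnj (f y) * f x
      = qcnj (inverse (v y)) * (qcnj (v y) * v x - qcnj (a * y + b) * (a * x + b)) * inverse (v x)"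
    using v(1) by (simp add: fv qcnj_mult right_diff_distrib left_diff_distrib mult.assoc)
  also have "qcnj (v y) * v x - qcnj (a * y + b) * (a * x + b) = of_real K * (1 - qcnj y * x)"
    using form by (simp add: v_def)
  finally have "norm (1 - qcnj (f y) * f x) = \<bar>r\<bar> * norm (1 - qcnj y * x)"
    by (simp add: r_def norm_mult norm_inverse divide_inverse abs_mult)
  then have "(norm (1 - qcnj (f y) * f x))\<^sup>2 = r\<^sup>2 * (norm (1 - qcnj y * x))\<^sup>2"
    by (simp add: power_mult_distrib)
  moreover have "(1 - (norm (f y))\<^sup>2) * (1 - (norm (f x))\<^sup>2)
      = r\<^sup>2 * ((1 - (norm y)\<^sup>2) * (1 - (norm x)\<^sup>2))"
    unfolding diag[OF x] diag[OF y] r_def v_def by (simp add: power2_eq_square ac_simps)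
  ultimately have "(norm (f y - f x))\<^sup>2 = (\<bar>r\<bar> * norm (y - x))\<^sup>2"
    unfolding norm_one_minus_qcnj_mult_squared by (simp add: power_mult_distrib algebra_simps)
  then have "norm (f y - f x) = \<bar>r\<bar> * norm (y - x)"
    by (rule power2_eq_imp_eq) simp_all
  then show "norm (f y - f x) = \<bar>K\<bar> / (norm (c * y + d) * norm (c * x + d)) * norm (y - x)"
    by (simp add: r_def v_def abs_mult)
qed

text \<open>
  In homogeneous coordinates \<open>A\<close> sends the column $(q,1)$ to $(u,v)$, and this is the column
  $(f(q),1)$ multiplied by $v$ from the right. Hence \<open>B\<close> sends $(f(q),1)$ to
  $(q v^{-1}, v^{-1})$: there is no pole at $f(q)$, and the quotient of the coordinates is $q$.
  Applied to points of the closed ball that are not poles this gives injectivity, and on the ball it exhibits the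
  inverse map as a Moebius transformation.
\<close>
lemma moebius_left_inverse:
  assumes "B ** A = mat 1" and v: "A $ 2 $ 1 * q + A $ 2 $ 2 \<noteq> 0"
  shows "B $ 2 $ 1 * moebius A q + B $ 2 $ 2 \<noteq> 0" "moebius B (moebius A q) = q"
proof -
  define v where "v = A $ 2 $ 1 * q + A $ 2 $ 2"
  define u where "u = A $ 1 $ 1 * q + A $ 1 $ 2"
  have "B $ i $ 1 * A $ 1 $ j + B $ i $ 2 * A $ 2 $ j = (if i = j then 1 else 0)" for i j
    using arg_cong[OF assms(1), of "\<lambda>M. M $ i $ j"]
    by (simp add: matrix_matrix_mult_def mat_def sum_2)
  note ent = this[of 1 1] this[of 1 2] this[of 2 1] this[of 2 2]
  have "B $ i $ 1 * u + B $ i $ 2 * v = (B $ i $ 1 * A $ 1 $ 1 + B $ i $ 2 * A $ 2 $ 1) * q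
      + (B $ i $ 1 * A $ 1 $ 2 + B $ i $ 2 * A $ 2 $ 2)" for i
    by (simp add: u_def v_def algebra_simps)
  note Buv = this[of 1] this[of 2]
  have v0: "v \<noteq> 0" using v by (simp add: v_def)
  have m: "moebius A q = u * inverse v" by (simp add: moebius_def u_def v_def)
  have "B $ i $ 1 * moebius A q + B $ i $ 2 = (B $ i $ 1 * u + B $ i $ 2 * v) * inverse v" for i
    using v0 by (simp add: m distrib_right mult.assoc)
  from this[of 1] this[of 2]
  have "B $ 1 $ 1 * moebius A q + B $ 1 $ 2 = q * inverse v"
    "B $ 2 $ 1 * moebius A q + B $ 2 $ 2 = inverse v"
    unfolding Buv ent by simp_all
  with v0 show "B $ 2 $ 1 * moebius A q + B $ 2 $ 2 \<noteq> 0" "moebius B (moebius A q) = q"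
    by (simp_all add: moebius_def[of B] mult.assoc)
qed

lemma moebius_rational_on:
  assumes "\<And>q. q \<in> S \<Longrightarrow> A $ 2 $ 1 * q + A $ 2 $ 2 \<noteq> 0"
  shows "rational_on S (moebius A)"
  unfolding moebius_def[abs_def]
  by (intro rational_on.intros bounded_linear_mult_right assms)

lemma norm_moebius_less_one_iff:
  assumes "A $ 2 $ 1 * q + A $ 2 $ 2 \<noteq> 0"
  shows "norm (moebius A q) < 1
    \<longleftrightarrow> norm (A $ 1 $ 1 * q + A $ 1 $ 2) < norm (A $ 2 $ 1 * q + A $ 2 $ 2)"
  unfolding moebius_def norm_mult norm_inverse using assms by (simp add: field_simps)

text \<open>
  By continuity $|u| \<le> |v|$ at boundary points. A strict inequality at $q$ would mean that
  $q$ is not a pole and is sent into the open ball, where its image is already taken by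
  a point of the ball, contradicting injectivity.
\<close>
lemma norm_moebius_sphere:
  assumes BA: "B ** A = mat 1"
    and pole: "\<And>q. q \<in> Delta_H \<Longrightarrow> A $ 2 $ 1 * q + A $ 2 $ 2 \<noteq> 0"
    and onto: "moebius A ` Delta_H = Delta_H" and q: "norm q = 1"
  shows "norm (A $ 1 $ 1 * q + A $ 1 $ 2) = norm (A $ 2 $ 1 * q + A $ 2 $ 2)"
proof (rule ccontr)
  define u where "u p = A $ 1 $ 1 * p + A $ 1 $ 2" for p
  define v where "v p = A $ 2 $ 1 * p + A $ 2 $ 2" for p
  assume "norm (A $ 1 $ 1 * q + A $ 1 $ 2) \<noteq> norm (A $ 2 $ 1 * q + A $ 2 $ 2)"
  moreover have "norm (u q) - norm (v q) \<le> 0"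
  proof (rule continuous_le_on_closure[where f = "\<lambda>p. norm (u p) - norm (v p)"])
    show "continuous_on (closure Delta_H) (\<lambda>p. norm (u p) - norm (v p))"
      unfolding u_def v_def by (intro continuous_intros)
    show "q \<in> closure Delta_H" using q by (simp add: closure_Delta_H)
    fix p assume p: "p \<in> Delta_H"
    then have "norm (moebius A p) < 1" using onto by (auto simp: Delta_H_def)
    then show "norm (u p) - norm (v p) \<le> 0"
      unfolding norm_moebius_less_one_iff[OF pole[OF p]] by (simp add: u_def v_def)
  qed
  ultimately have lt: "norm (u q) < norm (v q)" by (simp add: u_def v_def)
  then have v0: "A $ 2 $ 1 * q + A $ 2 $ 2 \<noteq> 0" by (auto simp: v_def)
  with lt have "moebius A q \<in> Delta_H"
    by (simp add: Delta_H_def norm_moebius_less_one_iff u_def v_def)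
  then obtain p where p: "p \<in> Delta_H" "moebius A p = moebius A q"
    using onto by (metis imageE)
  then have "p = q"
    using moebius_left_inverse(2)[OF BA] pole[OF p(1)] v0 by metis
  with p(1) q show False by (simp add: Delta_H_def)
qed

lemma moebius_leaves_poincare_metric_invariant:
  assumes "f \<in> MM"
  shows "leaves_poincare_metric_invariant f"
proof -
  obtain A where f: "f = restrict (moebius A) Delta_H" and "invertible A"
    and pole: "\<And>q. q \<in> Delta_H \<Longrightarrow> A $ 2 $ 1 * q + A $ 2 $ 2 \<noteq> 0"
    and onto: "moebius A ` Delta_H = Delta_H"
    using assms unfolding MM_def by blast
  then obtain B where BA: "B ** A = mat 1"
    unfolding invertible_def by blast
  have inv: "moebius B q \<in> Delta_H \<and> moebius A (moebius B q) = q
      \<and> B $ 2 $ 1 * q + B $ 2 $ 2 \<noteq> 0" if "q \<in> Delta_H" for q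
  proof -
    have "q \<in> moebius A ` Delta_H"
      using that by (simp only: onto)
    then obtain p where p: "p \<in> Delta_H" "q = moebius A p"
      by blast
    with that moebius_left_inverse[OF BA pole[OF p(1)]] show ?thesis by simp
  qed
  have rat: "rational_on Delta_H (moebius A)" "rational_on Delta_H (moebius B)"
    using pole inv by (auto intro: moebius_rational_on)
  have sm: "smooth_on Delta_H f"
    by (rule smooth_on_cong[OF open_Delta_H _ rational_on_imp_smooth_on[OF open_Delta_H rat(1)]])
      (simp add: f)
  have diffeo: "self_diffeomorphism Delta_H f"
    by (rule self_diffeomorphismI[where g = "moebius B"])
      (use onto inv moebius_left_inverse(2)[OF BA pole] sm
        rational_on_imp_smooth_on[OF open_Delta_H rat(2)] in \<open>auto simp: f open_Delta_H\<close>)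
  define a b c d where "a = A $ 1 $ 1" "b = A $ 1 $ 2" "c = A $ 2 $ 1" "d = A $ 2 $ 2"
  note abcd = this
  define K where "K = (norm d)\<^sup>2 - (norm b)\<^sup>2"
  have fq: "f q = (a * q + b) * inverse (c * q + d)" if "q \<in> Delta_H" for q
    using that by (simp add: f moebius_def abcd)
  have v: "c * q + d \<noteq> 0" if "q \<in> Delta_H" for q
    using pole[OF that] by (simp add: abcd)
  have sphere: "norm (a * q + b) = norm (c * q + d)" if "norm q = 1" for q
    unfolding abcd by (rule norm_moebius_sphere[OF BA pole onto that])
  have zero: "0 \<in> Delta_H" by (simp add: Delta_H_def)
  with onto have "norm (moebius A 0) < 1" by (auto simp: Delta_H_def)
  \<comment> \<open>The image of the origin lies in the ball, which makes the constant \<open>K\<close> positive.\<close>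
  then have "norm b < norm d"
    unfolding norm_moebius_less_one_iff[OF pole[OF zero]] by (simp add: abcd)
  then have K: "K > 0" by (simp add: K_def power_strict_mono)
  have "poincare_length (f q) (frechet_derivative f (at q) \<tau>) = poincare_length q \<tau>"
    if q: "q \<in> Delta_H" for q \<tau>
  proof -
    have "Ck_on 1 Delta_H f" using sm by (simp add: smooth_on_def)
    then have "(f has_derivative frechet_derivative f (at q)) (at q)"
      using q frechet_derivative_works by auto
    then have "norm (frechet_derivative f (at q) \<tau>)
        = \<bar>K\<bar> / (norm (c * q + d) * norm (c * q + d)) * norm \<tau>"
    proof (rule norm_derivative_eq_of_difference_quotient[OF open_Delta_H q,
          where g = "\<lambda>y. \<bar>K\<bar> / (norm (c * y + d) * norm (c * q + d))"])
      show "isCont (\<lambda>y. \<bar>K\<bar> / (norm (c * y + d) * norm (c * q + d))) q"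
        using v[OF q] by (intro continuous_intros) auto
      show "norm (f y - f q) = \<bar>K\<bar> / (norm (c * y + d) * norm (c * q + d)) * norm (y - q)"
        if "y \<in> Delta_H" for y
        unfolding fq[OF q] fq[OF that] K_def
        by (rule moebius_difference_norm(2)[OF sphere v[OF q] v[OF that]])
    qed
    moreover have "1 - (norm (f q))\<^sup>2 = K * (1 - (norm q)\<^sup>2) / (norm (c * q + d))\<^sup>2"
      unfolding fq[OF q] K_def
      by (rule moebius_difference_norm(1)[OF sphere v[OF q] v[OF q]])
    ultimately show ?thesis
      using K v[OF q] by (simp add: poincare_length_def power2_eq_square)
  qed
  with diffeo show ?thesis by (simp add: leaves_poincare_metric_invariant_def)
qed

lemma qcnj_leaves_poincare_metric_invariant: "leaves_poincare_metric_invariant qcnj"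
proof -
  have "smooth_on Delta_H qcnj"
    by (intro rational_on_imp_smooth_on open_Delta_H rational_on.linear bounded_linear_qcnj)
  then have "self_diffeomorphism Delta_H qcnj"
    by (intro self_diffeomorphismI[where g = qcnj] open_Delta_H) (auto simp: Delta_H_def)
  moreover have "frechet_derivative qcnj (at q) = qcnj" for q
    using frechet_derivative_at[OF bounded_linear_imp_has_derivative[OF bounded_linear_qcnj]]
    by simp
  ultimately show ?thesis
    by (simp add: leaves_poincare_metric_invariant_def poincare_length_def)
qed

theorem theorem1p9:
  "(\<forall>f\<in>MM. leaves_poincare_metric_invariant f) \<and> leaves_poincare_metric_invariant qcnj"
  using moebius_leaves_poincare_metric_invariant qcnj_leaves_poincare_metric_invariant by blast

end
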